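(* Let $s,r,l,z>0$ be distances, let $\epsilon\ge 2$ be the path-loss exponent, let $\bar\gamma>0$, and set $\eta_2=(l/z)^{-\epsilon}$ and $\eta_3=(s/r)^{-\epsilon}$. Let $|g|^2,|h|^2,|w|^2,|v|^2$ be mutually independent random variables, where $|g|^2$ and $|h|^2$ are exponentially distributed with mean $\bar\gamma$, and $|w|^2$ and $|v|^2$ are exponentially distributed with mean $1$. Define $$\gamma_3=\eta_2\frac{|g|^2}{|w|^2},\qquad \gamma_4=\eta_3\frac{|h|^2}{|v|^2},\qquad \gamma'_{\mathrm{su}_1}=\frac{\gamma_3\gamma_4}{\gamma_3+\gamma_4}.$$ Then for every $x>0$ the cumulative distribution function of $\gamma'_{\mathrm{su}_1}$ is $$F_{\gamma'_{\mathrm{su}_1}}(x)=1-\frac{\eta_2\eta_3\bar\gamma^2x^2}{2(x+\eta_2\bar\gamma)^2(x+\eta_3\bar\gamma)^2}\;{}_2F_1\!\left(2,2;3;\,1-\frac{x^2}{(x+\eta_2\bar\gamma)(x+\eta_3\bar\gamma)}\right),$$ and its probability density function is $$\begin{aligned} f_{\gamma'_{\mathrm{su}_1}}(x)={}&\frac{\eta_2\eta_3\bar\gamma^2x\,(x^2-\eta_2\eta_3\bar\gamma^2)}{(x+\eta_2\bar\gamma)^3(x+\eta_3\bar\gamma)^3}\;{}_2F_1\!\left(2,2;3;\,1-\frac{x^2}{(x+\eta_2\bar\gamma)(x+\eta_3\bar\gamma)}\right)\\ &+\frac{2\eta_2\eta_3\bar\gamma^2x^3\left[x(\eta_2\ba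r\gamma+\eta_3\bar\gamma)+2\eta_2\eta_3\bar\gamma^2\right]}{3(x+\eta_2\bar\gamma)^4(x+\eta_3\bar\gamma)^4}\;{}_2F_1\!\left(3,3;4;\,1-\frac{x^2}{(x+\eta_2\bar\gamma)(x+\eta_3\bar\gamma)}\right).\end{aligned}$$
   Context: ${}_2F_1(a,b;c;t)=\sum_{n\ge 0}\frac{(a)_n(b)_n}{(c)_n}\frac{t^n}{n!}$ for $|t|<1$ is the Gaussian hypergeometric function, with $(a)_n=a(a+1)\cdots(a+n-1)$. For $x>0$ its argument in the claim lies in $(0,1)$. Under the stated assumptions, $\gamma_3$ and $\gamma_4$ are independent positive random variables with densities, for $x>0$, $$f_{\gamma_3}(x)=\frac{\eta_2\bar\gamma}{(x+\eta_2\bar\gamma)^2},\qquad f_{\gamma_4}(x)=\frac{\eta_3\bar\gamma}{(x+\eta_3\bar\gamma)^2},$$ and distribution functions $F_{\gamma_3}(x)=1-\frac{\eta_2\bar\gamma}{x+\eta_2\bar\gamma}$ and $F_{\gamma_4}(x)=1-\frac{\eta_3\bar\gamma}{x+\eta_3\bar\gamma}$. Interpretation (not needed for the claim): $\gamma'_{\mathrm{su}_1}$ is an upper bound on the received signal-to-interference ratio at a secondary user in a two-way amplify-and-forward relaying link with Rayleigh fading. The variables $|g|^2,|h|^2$ are desired-channel gains, $|w|^2,|v|^2$ are interfering-channel gains, and $\bar\gamma$ is the average signal-to-noise ratio. *)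

theory Defs
  imports "HOL-Probability.Probability" "HOL-Real_Asymp.Real_Asymp"
begin

text \<open>The series converges for \<open>\<bar>t\<bar> < 1\<close> (shown below for positive parameters);
  where it diverges the value is unspecified.\<close>

definition hypergeo_2F1 :: "real \<Rightarrow> real \<Rightarrow> real \<Rightarrow> real \<Rightarrow> real" where
  "hypergeo_2F1 a b c t = eval_fps (fps_hypergeo [a, b] [c] 1) t"

lemma hypergeo_2F1_series:
  "hypergeo_2F1 a b c t =
    (\<Sum>n. pochhammer a n * pochhammer b n / pochhammer c n * (t ^ n / fact n))"
  by (simp add: hypergeo_2F1_def eval_fps_def)

lemma summable_hypergeo_2F1:
  fixes a b c t :: real
  assumes "a > 0" "b > 0" "c > 0" "\<bar>t\<bar> < 1"
  shows "summable (\<lambda>n. pochhammer a n * pochhammer b n / pochhammer c n * (t ^ n / fact n))"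
proof -
  define f where "f n = pochhammer a n * pochhammer b n / (pochhammer c n * fact n)" for n
  have pos: "pochhammer a n > 0" "pochhammer b n > 0" "pochhammer c n > 0" for n
    using assms by (auto intro!: pochhammer_pos)
  have nz: "f n \<noteq> 0" for n
    using pos[of n] by (simp add: f_def)
  have step: "f (Suc n) = f n * ((a + real n) * (b + real n) / ((c + real n) * (1 + real n)))" for n
    by (simp add: f_def pochhammer_Suc mult_ac)
  have ratio: "norm (f n) / norm (f (Suc n)) =
      (c + real n) * (1 + real n) / ((a + real n) * (b + real n))" for n
    using nz[of n] assms by (simp add: step abs_mult abs_divide)
  have "(\<lambda>n. (c + real n) * (1 + real n) / ((a + real n) * (b + real n))) \<longlonglongrightarrow> 1"
    by real_asymp
  then have "(\<lambda>n. norm (f n) / norm (f (Suc n))) \<longlonglongrightarrow> 1"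
    by (simp only: ratio)
  then have "conv_radius f = ereal 1"
    using nz by (intro conv_radius_ratio_limit_nonzero) simp_all
  then have "summable (\<lambda>n. f n * t ^ n)"
    using assms by (intro summable_in_conv_radius) auto
  then show ?thesis
    by (simp add: f_def)
qed

end

theory Submission
  imports Defs
begin

text \<open>
  Write \<open>A = \<eta>2 * \<gamma>bar\<close>, \<open>B = \<eta>3 * \<gamma>bar\<close>. Conditioning on the denominator of an exponential ratio
  gives the tails \<open>A / (x + A)\<close> and \<open>B / (x + B)\<close> of \<open>\<gamma>3\<close> and \<open>\<gamma>4\<close>. For positive values,
  \<open>\<gamma>3 * \<gamma>4 / (\<gamma>3 + \<gamma>4) > x\<close> means \<open>\<gamma>3 > x\<close> and \<open>\<gamma>4 > x * \<gamma>3 / (\<gamma>3 - x)\<close>, so conditioning on \<open>\<gamma>3\<close>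
  turns the tail of the quotient into the integral of a rational function. With
  \<open>q = x\<^sup>2 / ((x + A) * (x + B))\<close> its value is elementary in \<open>q\<close> and \<open>ln q\<close>, and it is matched with
  the closed form \<open>2 / t\<^sup>2 * (ln (1 - t) + t / (1 - t))\<close> of \<open>2F1(2,2;3;t)\<close> at \<open>t = 1 - q\<close>.
  The density is the derivative of this expression; since the variable is almost surely positive,
  its distribution function vanishes at \<open>0\<close> and no atom is left there.
\<close>

section \<open>The Gaussian hypergeometric series: derivative, continuity and a closed form\<close>

text \<open>Termwise differentiation inside the disc of convergence: the new factor
  \<open>n + 1\<close> cancels in the factorial, and each shifted Pochhammer symbol releases its
  first factor, \<open>a\<close>, \<open>b\<close> or \<open>c\<close>. With parameters 2, 2, 3 this
  produces the second term of the density.\<close>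

lemma has_real_derivative_hypergeo_2F1:
  fixes a b c t :: real
  assumes "a > 0" "b > 0" "c > 0" "\<bar>t\<bar> < 1"
  shows "(hypergeo_2F1 a b c has_real_derivative
           a * b / c * hypergeo_2F1 (a + 1) (b + 1) (c + 1) t) (at t)"
proof -
  define k where "k n = pochhammer a n * pochhammer b n / (pochhammer c n * fact n)" for n
  have F: "hypergeo_2F1 a b c = (\<lambda>t. \<Sum>n. k n * t ^ n)"
    by (simp add: fun_eq_iff hypergeo_2F1_series k_def)
  have "summable (\<lambda>n. k n * x ^ n)" if "norm x < 1" for x
    using summable_hypergeo_2F1[of a b c x] assms that by (simp add: k_def)
  then have "(hypergeo_2F1 a b c has_real_derivative (\<Sum>n. diffs k n * t ^ n)) (at t)"
    unfolding F using assms by (intro termdiffs_strong'[where K = 1]) auto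
  also have "(\<Sum>n. diffs k n * t ^ n) = (\<Sum>n. a * b / c * (pochhammer (a + 1) n *
      pochhammer (b + 1) n / pochhammer (c + 1) n * (t ^ n / fact n)))"
  proof (rule suminf_cong)
    fix n
    have "pochhammer (c + 1) n > 0"
      using assms by (intro pochhammer_pos) auto
    then show "diffs k n * t ^ n = a * b / c * (pochhammer (a + 1) n *
      pochhammer (b + 1) n / pochhammer (c + 1) n * (t ^ n / fact n))"
      using assms by (simp add: diffs_def k_def pochhammer_rec divide_simps del: of_nat_Suc)
  qed
  also have "\<dots> = a * b / c * hypergeo_2F1 (a + 1) (b + 1) (c + 1) t"
    unfolding hypergeo_2F1_series
    using assms by (intro suminf_mult summable_hypergeo_2F1) auto
  finally show ?thesis .
qed

lemma continuous_on_hypergeo_2F1: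
  fixes a b c :: real
  assumes "a > 0" "b > 0" "c > 0"
  shows "continuous_on {-1<..<1} (hypergeo_2F1 a b c)"
proof (rule continuous_at_imp_continuous_on, intro ballI)
  fix t :: real assume "t \<in> {-1<..<1}"
  then show "isCont (hypergeo_2F1 a b c) t"
    using assms by (intro DERIV_isCont[OF has_real_derivative_hypergeo_2F1]) auto
qed

text \<open>The coefficient of \<open>t ^ n\<close> is
  \<open>2 * (n + 1) / (n + 2) = 2 - 2 / (n + 2)\<close>, so the series is a geometric series minus
  a logarithmic series shifted by two places.\<close>

lemma hypergeo_2F1_2_2_3:
  fixes t :: real
  assumes "0 < t" "t < 1"
  shows "hypergeo_2F1 2 2 3 t = 2 / t\<^sup>2 * (ln (1 - t) + t / (1 - t))"
proof -
  \<comment> \<open>The term at \<open>n = 0\<close> is a division by zero and hence 0. Splitting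
    off the terms at 0 and 1 therefore only adds \<open>t\<close> to the sum.\<close>
  have "(\<lambda>n. - (t ^ n) / real n) sums ln (1 - t)"
    using ln_series'[of "- t"] assms by simp
  then have "(\<lambda>n. - (t ^ (n + 2)) / real (n + 2)) sums
      (ln (1 - t) - (\<Sum>n<2. - (t ^ n) / real n))"
    by (rule sums_split_initial_segment)
  then have "(\<lambda>n. - (t ^ (n + 2)) / real (n + 2)) sums (ln (1 - t) + t)"
    by (simp add: numeral_2_eq_2)
  from sums_mult[OF this, of "2 / t\<^sup>2"]
  have "(\<lambda>n. - (2 * t ^ n / real (n + 2))) sums (2 / t\<^sup>2 * (ln (1 - t) + t))"
    using assms by (simp add: power_add power2_eq_square)
  moreover have "(\<lambda>n. 2 * t ^ n) sums (2 * (1 / (1 - t)))"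
    using assms by (intro sums_mult geometric_sums) auto
  ultimately have "(\<lambda>n. 2 * t ^ n + - (2 * t ^ n / real (n + 2))) sums
      (2 * (1 / (1 - t)) + 2 / t\<^sup>2 * (ln (1 - t) + t))"
    by (intro sums_add)
  moreover have "2 * t ^ n + - (2 * t ^ n / real (n + 2)) =
      pochhammer 2 n * pochhammer 2 n / pochhammer 3 n * (t ^ n / fact n)" for n
  proof -
    \<comment> \<open>Both factorial forms come from \<open>pochhammer 1 n = fact n\<close> by
      removing leading factors.\<close>
    have p2: "pochhammer 2 n = (fact (n + 1) :: real)"
      using pochhammer_rec[of "1 :: real" n] by (simp flip: pochhammer_fact)
    have "2 * pochhammer 3 n = (fact (n + 2) :: real)"
      using pochhammer_rec[of "1 :: real" "Suc n"] pochhammer_rec[of "2 :: real" n]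
      by (simp flip: pochhammer_fact)
    then have p3: "pochhammer 3 n = (fact (n + 2) / 2 :: real)"
      by simp
    show ?thesis
      unfolding p2 p3 by (simp add: divide_simps add_nonneg_eq_0_iff) (simp add: algebra_simps)
  qed
  ultimately have "hypergeo_2F1 2 2 3 t = 2 * (1 / (1 - t)) + 2 / t\<^sup>2 * (ln (1 - t) + t)"
    by (simp add: hypergeo_2F1_series sums_iff)
  also have "\<dots> = 2 / t\<^sup>2 * (ln (1 - t) + t / (1 - t))"
    using assms by (simp add: divide_simps) (simp add: algebra_simps power2_eq_square)
  finally show ?thesis .
qed

section \<open>Conditioning on an independent variable, and densities from distribution
  functions\<close>

text \<open>By independence the joint law is a product measure, and Tonelli integrates the measure
  of the sections of \<open>S\<close>. It serves twice: with \<open>W\<close> or \<open>V\<close> as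
  \<open>X\<close> for an exponential ratio, and with \<open>\<gamma>3\<close> as \<open>X\<close>
  for the harmonic quotient.\<close>

lemma (in prob_space) emeasure_indep_var_density:
  assumes "indep_var borel X borel Y" and X: "distributed M lborel X f"
    and S: "S \<in> sets (borel \<Otimes>\<^sub>M borel)"
  shows "emeasure M {\<omega> \<in> space M. (X \<omega>, Y \<omega>) \<in> S} =
    (\<integral>\<^sup>+ x. f x * emeasure M {\<omega> \<in> space M. (x, Y \<omega>) \<in> S} \<partial>lborel)"
proof -
  have [measurable]: "X \<in> borel_measurable M" "Y \<in> borel_measurable M"
    and eq: "distr M borel X \<Otimes>\<^sub>M distr M borel Y = distr M (borel \<Otimes>\<^sub>M borel) (\<lambda>x. (X x, Y x))"
    using assms(1) by (auto simp: indep_var_distribution_eq)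
  note S[measurable]
  have [measurable]: "f \<in> borel_measurable borel"
    using distributed_borel_measurable[OF X] by simp
  interpret Y: prob_space "distr M borel Y"
    by (rule prob_space_distr) simp
  have S': "S \<in> sets (distr M borel X \<Otimes>\<^sub>M distr M borel Y)"
    using S by simp
  have "emeasure M {\<omega> \<in> space M. (X \<omega>, Y \<omega>) \<in> S} =
      emeasure (distr M borel X \<Otimes>\<^sub>M distr M borel Y) S"
    unfolding eq by (subst emeasure_distr) (auto intro!: arg_cong[where f = "emeasure M"])
  also have "\<dots> = (\<integral>\<^sup>+ x. emeasure (distr M borel Y) (Pair x -` S) \<partial>distr M borel X)"
    by (rule Y.emeasure_pair_measure_alt[OF S'])
  also have "distr M borel X = density lborel f"
    using distributed_distr_eq_density[OF X] by (simp cong: distr_cong)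
  also have "(\<integral>\<^sup>+ x. emeasure (distr M borel Y) (Pair x -` S) \<partial>density lborel f) =
      (\<integral>\<^sup>+ x. f x * emeasure (distr M borel Y) (Pair x -` S) \<partial>lborel)"
    using S' by (intro nn_integral_density) (auto intro!: Y.measurable_emeasure_Pair)
  also have "\<dots> = (\<integral>\<^sup>+ x. f x * emeasure M {\<omega> \<in> space M. (x, Y \<omega>) \<in> S} \<partial>lborel)"
    by (intro nn_integral_cong, subst emeasure_distr)
      (auto intro!: arg_cong[where f = "emeasure M"] arg_cong2[where f = "(*)"])
  finally show ?thesis .
qed

text \<open>The derivative is known only on the open half-line, so the fundamental theorem of
  calculus is applied on intervals \<open>{e n..a}\<close> with \<open>e n\<close> decreasing to 0,
  followed by a passage to the limit on both sides.\<close>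

lemma (in prob_space) distributed_of_cdf_derivative:
  fixes X f :: "_ \<Rightarrow> real"
  assumes X[measurable]: "X \<in> borel_measurable M" and pos: "AE \<omega> in M. 0 < X \<omega>"
    and deriv: "\<And>x. 0 < x \<Longrightarrow> (cdf (distr M borel X) has_real_derivative f x) (at x)"
    and cont: "continuous_on {0<..} f"
  shows "distributed M lborel X (\<lambda>x. ennreal (if x > 0 then f x else 0))"
proof -
  define F where "F = cdf (distr M borel X)"
  define g where "g x = (if x > 0 then f x else 0)" for x
  interpret D: real_distribution "distr M borel X"
    by (rule real_distribution_distr) simp
  have Fle: "F x \<le> F y" if "x \<le> y" for x y
    using that unfolding F_def by (rule D.cdf_nondecreasing)
  \<comment> \<open>Almost sure positivity rules out mass on the nonpositive half-line, in
    particular an atom at 0 that a density could not represent.\<close>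
  have "emeasure M {\<omega> \<in> space M. X \<omega> \<le> 0} = 0"
    using pos by (intro emeasure_eq_0_AE) (auto elim: eventually_mono)
  then have F0: "F 0 = 0"
    by (simp add: F_def cdf_def measure_def emeasure_distr vimage_def Int_def conj_commute)
  have [measurable]: "g \<in> borel_measurable borel"
  proof -
    have "g = (\<lambda>x. indicator {0<..} x *\<^sub>R f x)"
      by (auto simp: g_def fun_eq_iff)
    then show ?thesis
      using borel_measurable_continuous_on_indicator[OF _ cont] by simp
  qed
  \<comment> \<open>A derivative of a nondecreasing function is nonnegative, so the coercion to
    \<open>ennreal\<close> loses nothing.\<close>
  have g_nonneg: "0 \<le> g x" for x
  proof (cases "x > 0")
    case True
    have "mono F"
      using Fle by (auto simp: mono_def)
    then show ?thesis
      using deriv[OF True] True unfolding g_def F_def[symmetric]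
      by (auto intro: mono_on_imp_deriv_nonneg[where A = UNIV] simp: interior_open mono_on_def mono_def)
  qed (simp add: g_def)
  have int: "(\<integral>\<^sup>+ x. ennreal (g x) * indicator {..a} x \<partial>lborel) = ennreal (F a)" for a
  proof (cases "a > 0")
    case False
    then have "(\<integral>\<^sup>+ x. ennreal (g x) * indicator {..a} x \<partial>lborel) = (\<integral>\<^sup>+ x. 0 \<partial>(lborel :: real measure))"
      by (intro nn_integral_cong) (auto simp: g_def split: split_indicator)
    moreover have "F a = 0"
      using False Fle[of a 0] F0 D.cdf_nonneg[of a] by (simp add: F_def)
    ultimately show ?thesis
      by simp
  next
    case a: True
    define e where "e n = a / real (Suc n)" for n
    have e: "0 < e n" "e n \<le> a" for n
      using a by (auto simp: e_def divide_simps)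
    have dec: "e n \<le> e m" if "m \<le> n" for m n
      using a that by (auto simp: e_def intro!: divide_left_mono)
    have lim: "e \<longlonglongrightarrow> 0"
      unfolding e_def by real_asymp
    have int_n: "(\<integral>\<^sup>+ x. ennreal (g x) * indicator {e n..a} x \<partial>lborel) = ennreal (F a - F (e n))" for n
    proof (rule nn_integral_FTC_Icc)
      fix x assume "x \<in> {e n..a}"
      then have "0 < x"
        using e(1)[of n] by simp
      then show "(F has_real_derivative g x) (at x)"
        using deriv[of x] by (simp add: g_def F_def)
    qed (use e g_nonneg in auto)
    \<comment> \<open>Monotone convergence: the intervals grow to \<open>{0<..a}\<close>, and
      \<open>g\<close> vanishes at all other points of \<open>{..a}\<close>.\<close>
    have "(\<lambda>n. \<integral>\<^sup>+ x. ennreal (g x) * indicator {e n..a} x \<partial>lborel) \<longlonglongrightarrow>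
        (\<integral>\<^sup>+ x. ennreal (g x) * indicator {..a} x \<partial>lborel)"
    proof (rule nn_integral_LIMSEQ)
      show "incseq (\<lambda>n x. ennreal (g x) * indicator {e n..a} x)"
        by (auto simp: incseq_def le_fun_def split: split_indicator dest: dec)
      fix x
      have "eventually (\<lambda>n. ennreal (g x) * indicator {e n..a} x = ennreal (g x) * indicator {..a} x) sequentially"
      proof (cases "x > 0")
        case True
        from order_tendstoD(2)[OF lim this] show ?thesis
          by eventually_elim (auto split: split_indicator)
      qed (auto simp: g_def)
      then show "(\<lambda>n. ennreal (g x) * indicator {e n..a} x) \<longlonglongrightarrow> ennreal (g x) * indicator {..a} x"
        by (rule tendsto_eventually)
    qed auto
    \<comment> \<open>Right continuity at 0 suffices because every \<open>e n\<close> is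
      positive.\<close>
    moreover have "(\<lambda>n. F (e n)) \<longlonglongrightarrow> F 0"
    proof -
      have "(F \<longlongrightarrow> F 0) (at_right 0)"
        using D.cdf_is_right_cont[of 0] by (simp add: F_def continuous_within)
      moreover have "filterlim e (at_right 0) sequentially"
        by (rule tendsto_imp_filterlim_at_right[OF lim]) (simp add: e)
      ultimately show ?thesis
        by (rule filterlim_compose)
    qed
    then have "(\<lambda>n. ennreal (F a - F (e n))) \<longlonglongrightarrow> ennreal (F a - F 0)"
      by (intro tendsto_intros)
    ultimately show ?thesis
      using F0 unfolding int_n by (metis LIMSEQ_unique diff_zero)
  qed
  have "distributed M lborel X (\<lambda>x. ennreal (g x))"
  proof (rule distributedI_borel_atMost)
    show "emeasure M {\<omega> \<in> space M. X \<omega> \<le> a} = ennreal (F a)" for a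
      by (simp add: F_def cdf_def measure_distr emeasure_eq_measure vimage_def Int_def conj_commute)
    show "(\<integral>\<^sup>+ x. ennreal (g x * indicator {..a} x) \<partial>lborel) = ennreal (F a)" for a
      using int[of a] by (simp add: ennreal_mult'[OF g_nonneg] ennreal_indicator)
  qed (use g_nonneg in auto)
  then show ?thesis
    by (simp add: g_def)
qed

section \<open>Ratios of independent exponential variables\<close>

lemma nn_integral_exp_Ici:
  fixes k :: real
  assumes "0 < k"
  shows "(\<integral>\<^sup>+ w. ennreal (exp (- (k * w))) * indicator {0..} w \<partial>lborel) = ennreal (1 / k)"
proof -
  have "((\<lambda>w. - exp (- (k * w)) / k) \<longlongrightarrow> 0) at_top"
    using assms by real_asymp
  then have "(\<integral>\<^sup>+ w. ennreal (exp (- (k * w))) * indicator {0..} w \<partial>lborel) =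
      ennreal (0 - (- exp (- (k * 0)) / k))"
    using assms by (intro nn_integral_FTC_atLeast) (auto intro!: derivative_eq_intros)
  then show ?thesis
    by simp
qed

lemma (in prob_space) AE_exponential_pos:
  assumes "distributed M lborel X (exponential_density l)" "0 < l"
  shows "AE \<omega> in M. 0 < X \<omega>"
proof -
  have [measurable]: "X \<in> borel_measurable M"
    using distributed_measurable[OF assms(1)] by simp
  have "\<P>(\<omega> in M. 0 < X \<omega>) = 1"
    using exponential_distributedD_gt[OF assms(1) order_refl assms(2)] by simp
  then show ?thesis
    by (subst (asm) prob_Collect_eq_1) auto
qed

text \<open>Given \<open>W = w > 0\<close> the event reads \<open>G > x * w / \<eta>\<close>, whose
  probability is exponential in \<open>w\<close>; integrating it against the density of
  \<open>W\<close> leaves a single exponential integral.\<close>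

lemma (in prob_space) exponential_ratio_tail:
  fixes m \<eta> x :: real
  assumes "0 < m" "0 < \<eta>" "0 \<le> x"
    and indep: "indep_var borel W borel G"
    and W: "distributed M lborel W (exponential_density 1)"
    and G: "distributed M lborel G (exponential_density (1 / m))"
  shows "prob {\<omega> \<in> space M. x < \<eta> * (G \<omega> / W \<omega>)} = \<eta> * m / (x + \<eta> * m)"
proof -
  have [measurable]: "G \<in> borel_measurable M" "W \<in> borel_measurable M"
    using distributed_measurable[OF G] distributed_measurable[OF W] by auto
  \<comment> \<open>The combined rate: 1 from the density of \<open>W\<close>, the rest from the
    tail of \<open>G\<close>.\<close>
  define k where "k = 1 + x / (\<eta> * m)"
  have k: "0 < k"
    using assms by (simp add: k_def add_pos_nonneg)
  let ?S = "{p. x < \<eta> * (snd p / fst p)} :: (real \<times> real) set"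
  have "{p \<in> space (borel \<Otimes>\<^sub>M borel). x < \<eta> * (snd p / fst p)} \<in> sets (borel \<Otimes>\<^sub>M borel)"
    by measurable
  then have S: "?S \<in> sets (borel \<Otimes>\<^sub>M borel)"
    by (simp add: space_pair_measure)
  have "emeasure M {\<omega> \<in> space M. x < \<eta> * (G \<omega> / W \<omega>)} =
      emeasure M {\<omega> \<in> space M. (W \<omega>, G \<omega>) \<in> ?S}"
    by simp
  also have "\<dots> = (\<integral>\<^sup>+ w. ennreal (exponential_density 1 w) *
      emeasure M {\<omega> \<in> space M. (w, G \<omega>) \<in> ?S} \<partial>lborel)"
    by (rule emeasure_indep_var_density[OF indep W S])
  also have "\<dots> = (\<integral>\<^sup>+ w. ennreal (exp (- (k * w))) * indicator {0..} w \<partial>lborel)"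
  proof (intro nn_integral_cong_AE)
    \<comment> \<open>The integrands differ at \<open>w = 0\<close>: division by zero makes the
      event empty there, while the right side is 1. The point is a null set.\<close>
    show "AE w in lborel. ennreal (exponential_density 1 w) *
        emeasure M {\<omega> \<in> space M. (w, G \<omega>) \<in> ?S} =
        ennreal (exp (- (k * w))) * indicator {0..} w"
      using AE_lborel_singleton[of 0]
    proof eventually_elim
      case (elim w)
      show ?case
      proof (cases "w > 0")
        case True
        have "{\<omega> \<in> space M. (w, G \<omega>) \<in> ?S} = {\<omega> \<in> space M. x * w / \<eta> < G \<omega>}"
          using True assms by (auto simp: field_simps)
        then have "emeasure M {\<omega> \<in> space M. (w, G \<omega>) \<in> ?S} = ennreal (exp (- (x * w / \<eta>) * (1 / m)))"
          using exponential_distributedD_gt[OF G, of "x * w / \<eta>"] True assms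
          by (simp add: emeasure_eq_measure)
        then show ?thesis
          using True assms
          by (simp add: exponential_density_def k_def algebra_simps flip: ennreal_mult exp_add)
      qed (use elim in \<open>auto simp: exponential_density_def split: split_indicator\<close>)
    qed
  qed
  also have "\<dots> = ennreal (1 / k)"
    by (rule nn_integral_exp_Ici[OF k])
  finally have "prob {\<omega> \<in> space M. x < \<eta> * (G \<omega> / W \<omega>)} = 1 / k"
    using k by (simp add: emeasure_eq_measure)
  also have "1 / k = \<eta> * m / (x + \<eta> * m)"
    using assms by (simp add: k_def field_simps)
  finally show ?thesis .
qed

text \<open>Conditioning on \<open>\<gamma>3\<close> requires its density, which is obtained here by
  differentiating \<open>1 - A / (y + A)\<close>.\<close>

lemma (in prob_space) distributed_of_rational_tail:
  fixes X :: "_ \<Rightarrow> real" and A :: real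
  assumes A: "0 < A" and X[measurable]: "X \<in> borel_measurable M" and pos: "AE \<omega> in M. 0 < X \<omega>"
    and tail: "\<And>x. 0 \<le> x \<Longrightarrow> prob {\<omega> \<in> space M. x < X \<omega>} = A / (x + A)"
  shows "distributed M lborel X (\<lambda>x. ennreal (if x > 0 then A / (x + A)\<^sup>2 else 0))"
proof (rule distributed_of_cdf_derivative[OF X pos])
  fix x :: real assume x: "0 < x"
  have cdf: "cdf (distr M borel X) y = 1 - A / (y + A)" if "0 < y" for y
  proof -
    have "cdf (distr M borel X) y = prob {\<omega> \<in> space M. X \<omega> \<le> y}"
      by (simp add: cdf_def measure_distr vimage_def Int_def conj_commute)
    also have "\<dots> = 1 - prob {\<omega> \<in> space M. \<not> X \<omega> \<le> y}"
      by (subst prob_neg) auto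
    finally show ?thesis
      using tail[of y] that by (simp add: not_le)
  qed
  have "((\<lambda>y. 1 - A / (y + A)) has_real_derivative A / (x + A)\<^sup>2) (at x)"
    using x A by (auto intro!: derivative_eq_intros simp: power2_eq_square)
  \<comment> \<open>The formula for the distribution function holds on \<open>{0<..}\<close>, an
    open neighbourhood of \<open>x\<close>, which is enough to transfer the derivative.\<close>
  then show "(cdf (distr M borel X) has_real_derivative A / (x + A)\<^sup>2) (at x)"
    by (rule DERIV_cong_ev[THEN iffD2, rotated -1])
      (use x eventually_nhds_in_open[of "{0<..}" x] cdf in \<open>auto elim!: eventually_mono\<close>)
next
  show "continuous_on {0<..} (\<lambda>x. A / (x + A)\<^sup>2)"
    using A by (intro continuous_intros) auto
qed

section \<open>The tail of the harmonic quotient\<close>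

text \<open>The integral met after conditioning on \<open>\<gamma>3\<close>, solved by partial
  fractions. The assumption \<open>c < x + A\<close> keeps the two poles apart.\<close>

lemma nn_integral_harmonic_tail:
  fixes A K b c x :: real
  assumes "0 < A" "0 \<le> K" "0 < b" "0 < c" "0 < x" "c < x + A"
  defines "a \<equiv> x + A"
  shows "(\<integral>\<^sup>+ y. ennreal (K / (y + A)\<^sup>2 * ((y - x) / (b * (y - x + c)))) * indicator {x..} y \<partial>lborel) =
    ennreal (K / b * (1 / (a - c) - c / (a - c)\<^sup>2 * ln (a / c)))"
proof -
  \<comment> \<open>Antiderivative from the partial fractions with denominators
    \<open>y + A\<close>, \<open>y - x + c\<close> and \<open>(y + A)\<^sup>2\<close>. The
    logarithms enter with opposite coefficients, so it vanishes at infinity.\<close>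
  let ?\<Phi> = "\<lambda>y. K / b * (c / (a - c)\<^sup>2 * (ln (y + A) - ln (y - x + c)) - a / (a - c) / (y + A))"
  have "(?\<Phi> \<longlongrightarrow> 0) at_top"
    by real_asymp
  moreover have "(?\<Phi> has_real_derivative K / (y + A)\<^sup>2 * ((y - x) / (b * (y - x + c)))) (at y)"
    if "x \<le> y" for y
  proof -
    have p: "y + A > 0" "y - x + c > 0" "a - c > 0"
      using that assms by (auto simp: a_def)
    have "((\<lambda>y. k * (ln (y + A) - ln (y - x + c)) - h / (y + A)) has_real_derivative
        k * (1 / (y + A) - 1 / (y - x + c)) + h / (y + A)\<^sup>2) (at y)" for k h :: real
      using p by (auto intro!: derivative_eq_intros simp: power2_eq_square)
    from DERIV_cmult[OF this, of "K / b" "c / (a - c)\<^sup>2" "a / (a - c)"]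
    have "(?\<Phi> has_real_derivative
        K / b * (c / (a - c)\<^sup>2 * (1 / (y + A) - 1 / (y - x + c)) + a / (a - c) / (y + A)\<^sup>2)) (at y)" .
    moreover have "c / (a - c)\<^sup>2 * (1 / (y + A) - 1 / (y - x + c)) + a / (a - c) / (y + A)\<^sup>2 =
        (y - x) / ((y + A)\<^sup>2 * (y - x + c))"
    proof -
      \<comment> \<open>Since \<open>u - v = a - c\<close>, the claim becomes a rational identity in
        \<open>u\<close>, \<open>v\<close> and \<open>c\<close>.\<close>
      define u v where "u = y + A" and "v = y - x + c"
      have uv: "u > 0" "v > 0" "u - v > 0" "a - c = u - v" "y - x = v - c" "a = u - v + c"
        using p by (auto simp: u_def v_def a_def)
      show ?thesis
        unfolding u_def[symmetric] v_def[symmetric] uv(4,5) unfolding uv(6)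
        using uv(1-3) by (simp add: divide_simps power2_eq_square) (simp add: algebra_simps)
    qed
    ultimately show ?thesis
      by (simp add: mult_ac)
  qed
  ultimately have "(\<integral>\<^sup>+ y. ennreal (K / (y + A)\<^sup>2 * ((y - x) / (b * (y - x + c)))) * indicator {x..} y \<partial>lborel) =
      ennreal (0 - ?\<Phi> x)"
    using assms(1-6) by (intro nn_integral_FTC_atLeast) auto
  also have "0 - ?\<Phi> x = K / b * (1 / (a - c) - c / (a - c)\<^sup>2 * ln (a / c))"
  proof -
    have "?\<Phi> x = K / b * (c / (a - c)\<^sup>2 * ln (a / c) - 1 / (a - c))"
      using assms(1-6) by (simp add: a_def ln_div)
    then show ?thesis
      by (simp add: right_diff_distrib)
  qed
  finally show ?thesis .
qed

lemma (in prob_space) prob_harmonic_gt: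
  fixes X Y :: "_ \<Rightarrow> real" and A B x :: real
  assumes A: "0 < A" and B: "0 < B" and x: "0 < x"
    and indep: "indep_var borel X borel Y"
    and X: "distributed M lborel X (\<lambda>x. ennreal (if x > 0 then A / (x + A)\<^sup>2 else 0))"
    and pos: "AE \<omega> in M. 0 < X \<omega>" "AE \<omega> in M. 0 < Y \<omega>"
    and tail: "\<And>y. 0 \<le> y \<Longrightarrow> prob {\<omega> \<in> space M. y < Y \<omega>} = B / (y + B)"
  shows "prob {\<omega> \<in> space M. x < X \<omega> * Y \<omega> / (X \<omega> + Y \<omega>)} =
    A * B * x\<^sup>2 / (2 * (x + A)\<^sup>2 * (x + B)\<^sup>2) *
      hypergeo_2F1 2 2 3 (1 - x\<^sup>2 / ((x + A) * (x + B)))"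
proof -
  have [measurable]: "X \<in> borel_measurable M" "Y \<in> borel_measurable M"
    using indep by (auto simp: indep_var_distribution_eq)
  \<comment> \<open>The choice of \<open>c\<close> comes from \<open>x * y + B * (y - x) = b * (y -
    x) + x\<^sup>2 = b * (y - x + c)\<close>, which factors the conditional tail.\<close>
  define a b c q where "a = x + A" and "b = x + B" and "c = x\<^sup>2 / b" and "q = x\<^sup>2 / (a * b)"
  have ab: "0 < a" "0 < b" "0 < c" "x < a" "x < b"
    using A B x by (auto simp: a_def b_def c_def)
  have "x * x < a * b"
    using ab x by (intro mult_strict_mono) auto
  then have q: "0 < q" "q < 1" and ca: "c = q * a"
    using ab x by (auto simp: q_def c_def power2_eq_square)
  have "c < a"
    unfolding ca using q ab by simp
  let ?S = "{p. x < fst p \<and> x * fst p / (fst p - x) < snd p} :: (real \<times> real) set"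
  have "{p \<in> space (borel \<Otimes>\<^sub>M borel). x < fst p \<and> x * fst p / (fst p - x) < snd p} \<in>
      sets (borel \<Otimes>\<^sub>M borel :: (real \<times> real) measure)"
    by measurable
  then have S: "?S \<in> sets (borel \<Otimes>\<^sub>M borel)"
    by (simp add: space_pair_measure)
  have "emeasure M {\<omega> \<in> space M. x < X \<omega> * Y \<omega> / (X \<omega> + Y \<omega>)} =
      emeasure M {\<omega> \<in> space M. x < X \<omega> \<and> x * X \<omega> / (X \<omega> - x) < Y \<omega>}"
  proof (rule emeasure_eq_AE)
    show "AE \<omega> in M. \<omega> \<in> {\<omega> \<in> space M. x < X \<omega> * Y \<omega> / (X \<omega> + Y \<omega>)} \<longleftrightarrow>
        \<omega> \<in> {\<omega> \<in> space M. x < X \<omega> \<and> x * X \<omega> / (X \<omega> - x) < Y \<omega>}"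
      using pos
    proof eventually_elim
      case (elim \<omega>)
      have "x < X \<omega> * Y \<omega> / (X \<omega> + Y \<omega>) \<longleftrightarrow> x * X \<omega> < (X \<omega> - x) * Y \<omega>"
        using elim by (simp add: pos_less_divide_eq algebra_simps)
      also have "\<dots> \<longleftrightarrow> x < X \<omega> \<and> x * X \<omega> / (X \<omega> - x) < Y \<omega>"
      proof (cases "x < X \<omega>")
        case True
        then show ?thesis
          by (simp add: pos_divide_less_eq mult.commute)
      next
        \<comment> \<open>For \<open>X \<omega> \<le> x\<close> both sides fail: the product is
          nonpositive but \<open>x * X \<omega>\<close> is positive.\<close>
        case False
        then have "(X \<omega> - x) * Y \<omega> \<le> 0"
          using elim by (intro mult_nonpos_nonneg) auto
        moreover have "0 < x * X \<omega>"
          using elim x by simp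
        ultimately show ?thesis
          using False by simp
      qed
      finally show ?case
        by simp
    qed
  qed measurable
  also have "\<dots> = emeasure M {\<omega> \<in> space M. (X \<omega>, Y \<omega>) \<in> ?S}"
    by simp
  also have "\<dots> = (\<integral>\<^sup>+ y. ennreal (if y > 0 then A / (y + A)\<^sup>2 else 0) *
      emeasure M {\<omega> \<in> space M. (y, Y \<omega>) \<in> ?S} \<partial>lborel)"
    by (rule emeasure_indep_var_density[OF indep X S])
  \<comment> \<open>The closed half-line \<open>{x..}\<close> is harmless: at \<open>y = x\<close>
    the factor \<open>y - x\<close> makes the integrand vanish.\<close>
  also have "\<dots> = (\<integral>\<^sup>+ y. ennreal (A * B / (y + A)\<^sup>2 * ((y - x) / (b * (y - x + c)))) * indicator {x..} y \<partial>lborel)"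
  proof (rule nn_integral_cong)
    fix y :: real
    show "ennreal (if y > 0 then A / (y + A)\<^sup>2 else 0) * emeasure M {\<omega> \<in> space M. (y, Y \<omega>) \<in> ?S} =
      ennreal (A * B / (y + A)\<^sup>2 * ((y - x) / (b * (y - x + c)))) * indicator {x..} y"
    proof (cases "x < y")
      case True
      have "emeasure M {\<omega> \<in> space M. (y, Y \<omega>) \<in> ?S} = ennreal (B / (x * y / (y - x) + B))"
        using True x tail[of "x * y / (y - x)"] by (simp add: emeasure_eq_measure)
      also have "x * y / (y - x) + B = b * (y - x + c) / (y - x)"
        using True ab by (simp add: c_def divide_simps) (simp add: b_def algebra_simps power2_eq_square)
      finally show ?thesis
        using True A B x ab by (simp add: ennreal_mult[symmetric])
    next
      case False
      then show ?thesis
        using x by (cases "y = x") auto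
    qed
  qed
  also have "\<dots> = ennreal (A * B / b * (1 / (a - c) - c / (a - c)\<^sup>2 * ln (a / c)))"
    unfolding a_def using A B x ab \<open>c < a\<close>
    by (intro nn_integral_harmonic_tail) (auto simp: a_def)
  \<comment> \<open>Here \<open>a / c = 1 / q\<close> and \<open>a - c = a * (1 - q)\<close>, so the
    closed form applies at \<open>1 - q\<close>, where its logarithm is \<open>ln q\<close>.\<close>
  also have "A * B / b * (1 / (a - c) - c / (a - c)\<^sup>2 * ln (a / c)) =
      A * B * q / (2 * (a * b)) * hypergeo_2F1 2 2 3 (1 - q)"
  proof -
    have "ln (a / c) = - ln q"
      using q ab by (simp add: ca ln_div)
    moreover have "a - c = a * (1 - q)"
      by (simp add: ca algebra_simps)
    ultimately have "A * B / b * (1 / (a - c) - c / (a - c)\<^sup>2 * ln (a / c)) =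
        A * B / b * (1 / (a * (1 - q)) + q * a / (a * (1 - q))\<^sup>2 * ln q)"
      by (simp add: ca)
    also have "\<dots> = A * B * q / (2 * (a * b)) * (2 / (1 - q)\<^sup>2 * (ln q + (1 - q) / q))"
      using q ab by (simp add: divide_simps power2_eq_square) (simp add: algebra_simps)
    finally show ?thesis
      using hypergeo_2F1_2_2_3[of "1 - q"] q by simp
  qed
  also have "A * B * q / (2 * (a * b)) = A * B * x\<^sup>2 / (2 * a\<^sup>2 * b\<^sup>2)"
    by (simp add: q_def power2_eq_square)
  finally have "ennreal (prob {\<omega> \<in> space M. x < X \<omega> * Y \<omega> / (X \<omega> + Y \<omega>)}) =
      ennreal (A * B * x\<^sup>2 / (2 * a\<^sup>2 * b\<^sup>2) * hypergeo_2F1 2 2 3 (1 - q))"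
    by (simp add: emeasure_eq_measure)
  \<comment> \<open>Nonnegativity of both sides turns the equality in \<open>ennreal\<close> into
    one of reals.\<close>
  moreover have "0 \<le> hypergeo_2F1 2 2 3 (1 - q)"
    unfolding hypergeo_2F1_series using q
    by (intro suminf_nonneg summable_hypergeo_2F1) (auto intro!: divide_nonneg_nonneg mult_nonneg_nonneg pochhammer_nonneg)
  ultimately have "prob {\<omega> \<in> space M. x < X \<omega> * Y \<omega> / (X \<omega> + Y \<omega>)} =
      A * B * x\<^sup>2 / (2 * a\<^sup>2 * b\<^sup>2) * hypergeo_2F1 2 2 3 (1 - q)"
    using A B by (subst (asm) ennreal_inj) auto
  then show ?thesis
    by (simp add: a_def b_def q_def)
qed

section \<open>Differentiating the distribution function\<close>

lemma hypergeo_argument_bounds: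
  fixes A B x :: real
  assumes "0 < A" "0 < B" "0 < x"
  shows "0 < 1 - x\<^sup>2 / ((x + A) * (x + B))" "1 - x\<^sup>2 / ((x + A) * (x + B)) < 1"
proof -
  have "x * x < (x + A) * (x + B)"
    using assms by (intro mult_strict_mono) auto
  then show "0 < 1 - x\<^sup>2 / ((x + A) * (x + B))" "1 - x\<^sup>2 / ((x + A) * (x + B)) < 1"
    using assms by (auto simp: power2_eq_square)
qed

text \<open>Product rule: differentiating the rational prefactor gives the first term, and the chain
  rule through \<open>T\<close> gives the second, with \<open>4 / 3 = 2 * 2 / 3\<close> from the
  hypergeometric derivative.\<close>

lemma has_real_derivative_harmonic_cdf:
  fixes A B x :: real
  assumes A: "0 < A" and B: "0 < B" and x: "0 < x"
  defines "T \<equiv> \<lambda>x. 1 - x\<^sup>2 / ((x + A) * (x + B))"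
  shows "((\<lambda>x. 1 - A * B * x\<^sup>2 / (2 * (x + A)\<^sup>2 * (x + B)\<^sup>2) * hypergeo_2F1 2 2 3 (T x))
    has_real_derivative
      A * B * x * (x\<^sup>2 - A * B) / ((x + A) ^ 3 * (x + B) ^ 3) * hypergeo_2F1 2 2 3 (T x)
      + 2 * A * B * x ^ 3 * (x * (A + B) + 2 * A * B) / (3 * (x + A) ^ 4 * (x + B) ^ 4)
        * hypergeo_2F1 3 3 4 (T x)) (at x)"
proof -
  have T: "\<bar>T x\<bar> < 1"
    using hypergeo_argument_bounds[OF A B x] by (simp add: T_def)
  define u v where "u = x + A" and "v = x + B"
  \<comment> \<open>Substituting \<open>A = u - x\<close> and \<open>B = v - x\<close> brings the
    numerators of the density to the shape that the quotient rule yields.\<close>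
  have uv: "u > 0" "v > 0" and AB: "x\<^sup>2 - A * B = x * u + x * v - u * v"
      "x * (A + B) + 2 * A * B = 2 * u * v - x * u - x * v"
    using A B x by (auto simp: u_def v_def power2_eq_square algebra_simps)
  define dT dP where "dT = - (x * (2 * u * v - x * u - x * v)) / (u\<^sup>2 * v\<^sup>2)"
    and "dP = A * B * x * (u * v - x * u - x * v) / (u ^ 3 * v ^ 3)"
  have "(T has_real_derivative 0 - (2 * x * (u * v) - x\<^sup>2 * (v + u)) / ((u * v) * (u * v))) (at x)"
    unfolding T_def using uv by (auto intro!: derivative_eq_intros simp: u_def v_def)
  moreover have "0 - (2 * x * (u * v) - x\<^sup>2 * (v + u)) / ((u * v) * (u * v)) = dT"
    using uv by (simp add: dT_def divide_simps power2_eq_square) (simp add: algebra_simps)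
  ultimately have dT: "(T has_real_derivative dT) (at x)"
    by simp
  have dH: "((\<lambda>x. hypergeo_2F1 2 2 3 (T x)) has_real_derivative 4 / 3 * hypergeo_2F1 3 3 4 (T x) * dT) (at x)"
    using DERIV_chain2[OF has_real_derivative_hypergeo_2F1[of 2 2 3 "T x"] dT] T by simp
  have "((\<lambda>x. A * B * x\<^sup>2 / (2 * (x + A)\<^sup>2 * (x + B)\<^sup>2)) has_real_derivative
      (A * B * (2 * x) * (2 * u\<^sup>2 * v\<^sup>2) - A * B * x\<^sup>2 * (2 * (2 * u) * v\<^sup>2 + 2 * u\<^sup>2 * (2 * v))) /
        ((2 * u\<^sup>2 * v\<^sup>2) * (2 * u\<^sup>2 * v\<^sup>2))) (at x)"
    using uv by (auto intro!: derivative_eq_intros simp: u_def v_def)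
  moreover have "(A * B * (2 * x) * (2 * u\<^sup>2 * v\<^sup>2) - A * B * x\<^sup>2 * (2 * (2 * u) * v\<^sup>2 + 2 * u\<^sup>2 * (2 * v))) /
        ((2 * u\<^sup>2 * v\<^sup>2) * (2 * u\<^sup>2 * v\<^sup>2)) = dP"
    using uv by (simp add: dP_def divide_simps power2_eq_square power3_eq_cube) (simp add: algebra_simps)
  ultimately have dP: "((\<lambda>x. A * B * x\<^sup>2 / (2 * (x + A)\<^sup>2 * (x + B)\<^sup>2)) has_real_derivative dP) (at x)"
    by simp
  have deriv: "((\<lambda>x. 1 - A * B * x\<^sup>2 / (2 * (x + A)\<^sup>2 * (x + B)\<^sup>2) * hypergeo_2F1 2 2 3 (T x)) has_real_derivative
      0 - (dP * hypergeo_2F1 2 2 3 (T x) + 4 / 3 * hypergeo_2F1 3 3 4 (T x) * dT *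
        (A * B * x\<^sup>2 / (2 * (x + A)\<^sup>2 * (x + B)\<^sup>2)))) (at x)"
    by (intro DERIV_diff DERIV_const DERIV_mult dP dH)
  have dP_eq: "- dP = A * B * x * (x\<^sup>2 - A * B) / ((x + A) ^ 3 * (x + B) ^ 3)"
    unfolding AB dP_def u_def[symmetric] v_def[symmetric] minus_divide_left
    by (rule arg_cong2[where f = "(/)"]) (simp_all add: algebra_simps)
  have dT_eq: "- (4 / 3 * dT * (A * B * x\<^sup>2 / (2 * (x + A)\<^sup>2 * (x + B)\<^sup>2))) =
      2 * A * B * x ^ 3 * (x * (A + B) + 2 * A * B) / (3 * (x + A) ^ 4 * (x + B) ^ 4)"
    unfolding AB dT_def u_def[symmetric] v_def[symmetric]
    using uv by (simp add: divide_simps) (simp add: eval_nat_numeral)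
  \<comment> \<open>Separates the two hypergeometric values, leaving only their rational
    coefficients to be matched.\<close>
  have expand: "0 - (p * h + 4 / 3 * k * d * w) = - p * h + - (4 / 3 * d * w) * k" for p h k d w :: real
    by (simp add: algebra_simps)
  show ?thesis
    using deriv unfolding expand dP_eq dT_eq .
qed

section \<open>Independence of the two ratios, and assembly of the result\<close>

theorem proposition1:
  fixes M :: "'a measure"
    and G H W V \<gamma>3 \<gamma>4 \<gamma>su :: "'a \<Rightarrow> real"
    and s r l z \<epsilon> \<gamma>bar \<eta>2 \<eta>3 :: real
    and f :: "real \<Rightarrow> real"
  assumes "prob_space M"
    and "s > 0" "r > 0" "l > 0" "z > 0" "\<epsilon> \<ge> 2" "\<gamma>bar > 0"
    and \<eta>2: "\<eta>2 = (l / z) powr (- \<epsilon>)"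
    and \<eta>3: "\<eta>3 = (s / r) powr (- \<epsilon>)"
    and indep: "prob_space.indep_vars M (\<lambda>_. borel) (\<lambda>i. [G, H, W, V] ! i) {..<4::nat}"
    and G: "distributed M lborel G (exponential_density (1 / \<gamma>bar))"
    and H: "distributed M lborel H (exponential_density (1 / \<gamma>bar))"
    and W: "distributed M lborel W (exponential_density 1)"
    and V: "distributed M lborel V (exponential_density 1)"
    and \<gamma>3: "\<gamma>3 = (\<lambda>\<omega>. \<eta>2 * (G \<omega> / W \<omega>))"
    and \<gamma>4: "\<gamma>4 = (\<lambda>\<omega>. \<eta>3 * (H \<omega> / V \<omega>))"
    and \<gamma>su: "\<gamma>su = (\<lambda>\<omega>. \<gamma>3 \<omega> * \<gamma>4 \<omega> / (\<gamma>3 \<omega> + \<gamma>4 \<omega>))"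
    and f: "f = (\<lambda>x.
        \<eta>2 * \<eta>3 * \<gamma>bar^2 * x * (x^2 - \<eta>2 * \<eta>3 * \<gamma>bar^2)
          / ((x + \<eta>2 * \<gamma>bar)^3 * (x + \<eta>3 * \<gamma>bar)^3)
          * hypergeo_2F1 2 2 3 (1 - x^2 / ((x + \<eta>2 * \<gamma>bar) * (x + \<eta>3 * \<gamma>bar)))
      + 2 * \<eta>2 * \<eta>3 * \<gamma>bar^2 * x^3
            * (x * (\<eta>2 * \<gamma>bar + \<eta>3 * \<gamma>bar) + 2 * \<eta>2 * \<eta>3 * \<gamma>bar^2)
          / (3 * (x + \<eta>2 * \<gamma>bar)^4 * (x + \<eta>3 * \<gamma>bar)^4)
          * hypergeo_2F1 3 3 4 (1 - x^2 / ((x + \<eta>2 * \<gamma>bar) * (x + \<eta>3 * \<gamma>bar))))"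
  shows "(\<forall>x>0. cdf (distr M borel \<gamma>su) x =
            1 - \<eta>2 * \<eta>3 * \<gamma>bar^2 * x^2 / (2 * (x + \<eta>2 * \<gamma>bar)^2 * (x + \<eta>3 * \<gamma>bar)^2)
              * hypergeo_2F1 2 2 3 (1 - x^2 / ((x + \<eta>2 * \<gamma>bar) * (x + \<eta>3 * \<gamma>bar))))
       \<and> distributed M lborel \<gamma>su (\<lambda>x. ennreal (if x > 0 then f x else 0))
       \<and> (\<forall>x>0. (cdf (distr M borel \<gamma>su) has_real_derivative f x) (at x))"
proof -
  interpret prob_space M by fact
  define A B where "A = \<eta>2 * \<gamma>bar" and "B = \<eta>3 * \<gamma>bar"
  have \<eta>: "0 < \<eta>2" "0 < \<eta>3"
    using assms(2-5) by (auto simp: \<eta>2 \<eta>3)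
  have A: "0 < A" and B: "0 < B"
    using \<eta> \<open>\<gamma>bar > 0\<close> by (auto simp: A_def B_def)
  have AB: "\<eta>2 * \<eta>3 * \<gamma>bar\<^sup>2 = A * B"
    by (simp add: A_def B_def power2_eq_square)
  have [measurable]: "G \<in> borel_measurable M" "H \<in> borel_measurable M"
      "W \<in> borel_measurable M" "V \<in> borel_measurable M"
    using distributed_measurable[OF G] distributed_measurable[OF H]
      distributed_measurable[OF W] distributed_measurable[OF V] by auto
  have [measurable]: "\<gamma>3 \<in> borel_measurable M" "\<gamma>4 \<in> borel_measurable M"
    unfolding \<gamma>3 \<gamma>4 by measurable
  have [measurable]: "\<gamma>su \<in> borel_measurable M"
    unfolding \<gamma>su by measurable

  \<comment> \<open>Measurable functions of disjoint blocks of an independent family are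
    independent. Indices 0 to 3 stand for \<open>G\<close>, \<open>H\<close>, \<open>W\<close>,
    \<open>V\<close>, so \<open>\<gamma>3\<close> lives on \<open>{0, 2}\<close> and
    \<open>\<gamma>4\<close> on \<open>{1, 3}\<close>.\<close>
  have split: "indep_var borel (\<lambda>\<omega>. g (restrict (\<lambda>i. ([G, H, W, V] ! i) \<omega>) I))
      borel (\<lambda>\<omega>. h (restrict (\<lambda>i. ([G, H, W, V] ! i) \<omega>) J))"
    if "I \<inter> J = {}" "I \<subseteq> {..<4}" "J \<subseteq> {..<4}"
      "g \<in> borel_measurable (PiM I (\<lambda>_. borel))" "h \<in> borel_measurable (PiM J (\<lambda>_. borel))"
    for I J and g h :: "(nat \<Rightarrow> real) \<Rightarrow> real"
    using indep_var_compose[OF indep_var_restrict[OF indep that(1-3)] that(4,5)]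
    by (simp add: comp_def)
  have indep_WG: "indep_var borel W borel G"
    using split[of "{2}" "{0}" "\<lambda>x. x 2" "\<lambda>x. x 0"] by simp
  have indep_VH: "indep_var borel V borel H"
    using split[of "{3}" "{1}" "\<lambda>x. x 3" "\<lambda>x. x 1"] by simp
  have indep_34: "indep_var borel \<gamma>3 borel \<gamma>4"
    using split[of "{0, 2}" "{1, 3}" "\<lambda>x. \<eta>2 * (x 0 / x 2)" "\<lambda>x. \<eta>3 * (x 1 / x 3)"]
    by (simp add: \<gamma>3 \<gamma>4)

  have m: "0 < 1 / \<gamma>bar"
    using \<open>\<gamma>bar > 0\<close> by simp
  have pos3: "AE \<omega> in M. 0 < \<gamma>3 \<omega>"
    using AE_exponential_pos[OF G m] AE_exponential_pos[OF W zero_less_one]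
    by eventually_elim (use \<eta> in \<open>simp add: \<gamma>3\<close>)
  have pos4: "AE \<omega> in M. 0 < \<gamma>4 \<omega>"
    using AE_exponential_pos[OF H m] AE_exponential_pos[OF V zero_less_one]
    by eventually_elim (use \<eta> in \<open>simp add: \<gamma>4\<close>)
  have tail3: "prob {\<omega> \<in> space M. x < \<gamma>3 \<omega>} = A / (x + A)" if "0 \<le> x" for x
    unfolding \<gamma>3 A_def using \<open>\<gamma>bar > 0\<close> \<eta>(1) that indep_WG W G by (rule exponential_ratio_tail)
  have tail4: "prob {\<omega> \<in> space M. x < \<gamma>4 \<omega>} = B / (x + B)" if "0 \<le> x" for x
    unfolding \<gamma>4 B_def using \<open>\<gamma>bar > 0\<close> \<eta>(2) that indep_VH V H by (rule exponential_ratio_tail)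
  have X3: "distributed M lborel \<gamma>3 (\<lambda>x. ennreal (if x > 0 then A / (x + A)\<^sup>2 else 0))"
    using A _ pos3 tail3 by (rule distributed_of_rational_tail) measurable

  let ?F = "\<lambda>x. 1 - A * B * x\<^sup>2 / (2 * (x + A)\<^sup>2 * (x + B)\<^sup>2) *
      hypergeo_2F1 2 2 3 (1 - x\<^sup>2 / ((x + A) * (x + B)))"
  have cdf: "cdf (distr M borel \<gamma>su) x = ?F x" if "0 < x" for x
  proof -
    have "cdf (distr M borel \<gamma>su) x = prob {\<omega> \<in> space M. \<gamma>su \<omega> \<le> x}"
      by (simp add: cdf_def measure_distr vimage_def Int_def conj_commute)
    also have "\<dots> = 1 - prob {\<omega> \<in> space M. \<not> \<gamma>su \<omega> \<le> x}"
      by (subst prob_neg) auto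
    finally show ?thesis
      using prob_harmonic_gt[OF A B that indep_34 X3 pos3 pos4 tail4] by (simp add: \<gamma>su not_le)
  qed
  have f_eq: "f = (\<lambda>x. A * B * x * (x\<^sup>2 - A * B) / ((x + A) ^ 3 * (x + B) ^ 3) *
        hypergeo_2F1 2 2 3 (1 - x\<^sup>2 / ((x + A) * (x + B)))
      + 2 * A * B * x ^ 3 * (x * (A + B) + 2 * A * B) / (3 * (x + A) ^ 4 * (x + B) ^ 4) *
        hypergeo_2F1 3 3 4 (1 - x\<^sup>2 / ((x + A) * (x + B))))"
    \<comment> \<open>The leading 2 is first bracketed with \<open>\<eta>2\<close>; reassociating
      exposes the product that \<open>AB\<close> rewrites.\<close>
    unfolding f AB mult.assoc[of 2] A_def[symmetric] B_def[symmetric] by (simp add: AB mult.assoc)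
  have deriv: "(cdf (distr M borel \<gamma>su) has_real_derivative f x) (at x)" if "0 < x" for x
    using has_real_derivative_harmonic_cdf[OF A B that, folded f_eq]
    by (rule DERIV_cong_ev[THEN iffD2, rotated -1])
      (use that eventually_nhds_in_open[of "{0<..}" x] cdf in \<open>auto elim!: eventually_mono simp: f_eq\<close>)
  have pos: "AE \<omega> in M. 0 < \<gamma>su \<omega>"
    using pos3 pos4 by eventually_elim (simp add: \<gamma>su)
  have cont: "continuous_on {0<..} f"
  proof -
    let ?T = "\<lambda>x. 1 - x\<^sup>2 / ((x + A) * (x + B))"
    have "?T x \<in> {-1<..<1}" if "0 < x" for x
      using hypergeo_argument_bounds[OF A B that] by simp
    then have T: "continuous_on {0<..} ?T" "?T ` {0<..} \<subseteq> {-1<..<1}"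
      using A B by (force intro!: continuous_intros, intro image_subsetI) (simp only: greaterThan_iff)
    have "continuous_on {0<..} (\<lambda>x. hypergeo_2F1 a b c (?T x))" if "a > 0" "b > 0" "c > 0" for a b c
      using continuous_on_compose2[OF continuous_on_hypergeo_2F1[OF that] T] .
    then show ?thesis
      unfolding f_eq using A B by (intro continuous_intros) auto
  qed
  have "distributed M lborel \<gamma>su (\<lambda>x. ennreal (if x > 0 then f x else 0))"
    using _ pos deriv cont by (rule distributed_of_cdf_derivative) measurable
  then show ?thesis
    using cdf deriv by (simp add: AB flip: A_def B_def)
qed

end
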